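(* Let $P$ be a polyhedron such that $P\subset\mathcal B=\{z\in\mathbb{R}^d:\|z\|_\nu\le1\}$ and let $r_P=\sup_{\|z\|_P=1}\|z\|_\nu$. Let $Q$ be a polyhedron such that $\mathcal B\subset Q$ and let $R_Q=\inf_{\|z\|_Q=1}\|z\|_\nu$. Let $\lambda_1,\dots,\lambda_n\ge0$ and let the globalizing function be $\Phi(\varepsilon_1,\dots,\varepsilon_n)=\sum_{i=1}^n\lambda_i\varepsilon_{(i)}^{\delta}$. Then $$\Phi_{P^*}\ \le\ \Phi_{\ell_\tau}\ \le\ \frac1{r_P^{\delta}}\,\Phi_{P^*},$$ $$\frac1{R_Q^{\delta}}\,\Phi_{Q^*}\ \le\ \Phi_{\ell_\tau}\ \le\ \Phi_{Q^*}.$$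
   Context: Here $\tau\ge1$ and $\nu$ are conjugate exponents, $\frac1\tau+\frac1\nu=1$. $P$ and $Q$ are unit balls of polyhedral (block) norms, i.e. polytopes symmetric with respect to the origin with nonempty interior; $\|\cdot\|_P$, $\|\cdot\|_Q$ are the norms on $\mathbb{R}^d$ with unit balls $P$, $Q$, and $P^*$, $Q^*$ are the polar sets (unit balls of the dual norms). $r_P$ is described as the radius of the smallest $\ell_\nu$-ball containing $P$ and $R_Q$ as the radius of the largest $\ell_\nu$-ball contained in $Q$. $\varepsilon_{(1)}\le\dots\le\varepsilon_{(n)}$ is the vector $\varepsilon$ sorted in nondecreasing order. Vectors in $\mathbb{R}^{d+1}$ are indexed $0,\dots,d$ and $y_{-0}=(y_1,\dots,y_d)$; the data are points $x_1,\dots,x_n\in\mathbb{R}^{d+1}$ with $0$-th coordinate $1$; $\mathcal H(\beta)=\{y\in\mathbb{R}^d:(1,y^t)\beta=0\}$ for $\beta\in\mathbb{R}^{d+1}$. $\Phi_{P^*}$, $\Phi_{Q^*}$, $\Phi_{\ell_\tau}$ denote the value of $\Phi$ at the vector of residuals $\big(\min_{y\in\mathcal H(\beta)}\|(x_i)_{-0}-y\|\big)_{i=1}^n$ for a given (common) $\beta$, where $\|\cdot\|$ is respectively the norm with unit ball $P^*$, the norm with unit ball $Q^*$, and the $\ell_\tau$-norm.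
   Formalization: The supremum in r_P and the infimum in R_Q are exchanged (r_P is the infimum, R_Q the supremum), since as printed the bounds fail, e.g. for the cross-polytope in the Euclidean disc and the square around it; δ is taken positive and H(β) nonempty. *)

theory Defs
  imports "HOL-Analysis.Analysis"
begin

definition lp_norm :: "ennreal \<Rightarrow> real ^ 'd \<Rightarrow> real" where
  "lp_norm p z =
     (if p = \<infinity> then infnorm z
      else (\<Sum>i\<in>UNIV. \<bar>z $ i\<bar> powr enn2real p) powr (1 / enn2real p))"

definition norm_ball :: "'a::euclidean_space set \<Rightarrow> bool" where
  "norm_ball P \<longleftrightarrow> polytope P \<and> uminus ` P = P \<and> interior P \<noteq> {}"

text \<open>The norm with unit ball \<open>P\<close> (Minkowski functional).\<close>

definition ball_norm :: "'a::real_vector set \<Rightarrow> 'a \<Rightarrow> real" where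
  "ball_norm P z = Inf {t. 0 < t \<and> z \<in> (*\<^sub>R) t ` P}"

definition polar :: "'a::real_inner set \<Rightarrow> 'a set" where
  "polar P = {w. \<forall>z\<in>P. w \<bullet> z \<le> 1}"

text \<open>
  The radius of the largest \<open>lp_norm p\<close>-ball contained in \<open>P\<close> and of the smallest one
  containing \<open>P\<close>; that is, the best constants with
  \<open>inner_radius p P * ball_norm P z \<le> lp_norm p z \<le> outer_radius p P * ball_norm P z\<close>.
  The source prints a supremum for the radius of the inscribed polytope and an infimum for the
  radius of the circumscribed one. With those constants both bounds in which the radii occur fail,
  for example for the cross-polytope inscribed in the Euclidean disc and the square circumscribed
  about it, so infimum and supremum are exchanged here.
\<close>

definition inner_radius :: "ennreal \<Rightarrow> (real ^ 'd) set \<Rightarrow> real" where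
  "inner_radius p P = (INF z\<in>{z. ball_norm P z = 1}. lp_norm p z)"

definition outer_radius :: "ennreal \<Rightarrow> (real ^ 'd) set \<Rightarrow> real" where
  "outer_radius p P = (SUP z\<in>{z. ball_norm P z = 1}. lp_norm p z)"

text \<open>A vector indexed by \<open>0,\<dots>,d\<close> is a pair: \<open>fst\<close> is the coordinate with index 0
  and \<open>snd\<close> is the vector of the remaining ones.\<close>

definition hyperplane :: "real \<times> 'a::real_inner \<Rightarrow> 'a set" where
  "hyperplane \<beta> = {y. (1, y) \<bullet> \<beta> = 0}"

text \<open>The infimum below is attained whenever \<open>N\<close> is a norm on a finite-dimensional space and
  \<open>hyperplane \<beta>\<close> is nonempty.\<close>

definition residual :: "('a::real_inner \<Rightarrow> real) \<Rightarrow> real \<times> 'a \<Rightarrow> real \<times> 'a \<Rightarrow> real" where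
  "residual N \<beta> x = (INF y\<in>hyperplane \<beta>. N (snd x - y))"

text \<open>Indices are shifted by one: \<open>i < n\<close> stands for \<open>i + 1\<close> in \<open>{1..n}\<close>.\<close>

definition ordered_sum ::
    "nat \<Rightarrow> (nat \<Rightarrow> real) \<Rightarrow> real \<Rightarrow> (nat \<Rightarrow> real) \<Rightarrow> real" where
  "ordered_sum n lam \<delta> \<epsilon> = (\<Sum>i<n. lam i * (sort (map \<epsilon> [0..<n]) ! i) powr \<delta>)"

end

theory Submission
  imports Defs
begin

text \<open>
  The norm with unit ball \<open>polar S\<close> is the support function of \<open>S\<close>, and by Hoelder's inequality
  with its equality case \<open>lp_norm \<tau>\<close> is the support function of the \<open>\<nu>\<close>-ball \<open>B\<close>. Hence the
  inclusions \<open>r B \<subseteq> P \<subseteq> B \<subseteq> Q \<subseteq> R B\<close> give pointwise inequalities between the norms. These pass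
  to infima over the hyperplane, then to order statistics, because the \<open>i\<close>-th smallest entry of a
  vector is monotone in the vector, and finally to the weighted sum of powers.
\<close>

section \<open>Conjugate exponents and basic estimates for \<open>lp_norm\<close>\<close>

lemma conjugate_exponents_cases:
  fixes \<tau> \<nu> :: ennreal
  assumes "1 \<le> \<tau>" and conj: "1 / \<tau> + 1 / \<nu> = 1"
  obtains "\<tau> = \<infinity>" "\<nu> = 1"
    | "\<tau> = 1" "\<nu> = \<infinity>"
    | p q where "\<tau> = ennreal p" "\<nu> = ennreal q" "1 < p" "1 < q" "1 / p + 1 / q = 1"
proof (cases \<tau>)
  case top
  with conj have "1 / \<nu> = 1" by simp
  with top that(1) show ?thesis by (simp add: divide_eq_1_ennreal)
next
  case (real p)
  have "1 \<le> p" using assms(1) real by simp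
  show ?thesis
  proof (cases \<nu>)
    case top
    with conj have "1 / \<tau> = 1" by simp
    with top that(2) show ?thesis by (simp add: divide_eq_1_ennreal)
  next
    case (real q)
    \<comment> \<open>In \<open>ennreal\<close>, dividing 1 by 0 gives \<infinity>, so the sum of
      the reciprocals could not be 1.\<close>
    have "q \<noteq> 0" using conj real by (auto simp: divide_ennreal_def)
    then have q: "0 < q" using real by simp
    have "ennreal (1 / p + 1 / q) = 1 / \<tau> + 1 / \<nu>"
      using \<open>1 \<le> p\<close> q \<open>\<tau> = ennreal p\<close> \<open>\<nu> = ennreal q\<close>
      by (simp add: divide_ennreal flip: ennreal_1)
    also have "\<dots> = ennreal 1" using conj by simp
    finally have pq: "1 / p + 1 / q = 1"
      using \<open>1 \<le> p\<close> q by (subst (asm) ennreal_inj) auto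
    have "0 < 1 / q" "0 < 1 / p" using q \<open>1 \<le> p\<close> by auto
    then have "1 / p < 1" "1 / q < 1" using pq by linarith+
    then have "1 < p" "1 < q" using q \<open>1 \<le> p\<close> by (auto simp: divide_less_eq_1)
    with that(3) pq real \<open>\<tau> = ennreal p\<close> show ?thesis by blast
  qed
qed

lemma lp_norm_infty: "lp_norm \<infinity> z = infnorm z"
  by (simp add: lp_norm_def)

lemma lp_norm_1: "lp_norm 1 z = (\<Sum>i\<in>UNIV. \<bar>z $ i\<bar>)"
  by (simp add: lp_norm_def sum_nonneg)

lemma lp_norm_ennreal:
  "0 \<le> p \<Longrightarrow> lp_norm (ennreal p) z = (\<Sum>i\<in>UNIV. \<bar>z $ i\<bar> powr p) powr (1 / p)"
  by (simp add: lp_norm_def)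

lemma lp_norm_nonneg: "0 \<le> lp_norm p z"
  by (simp add: lp_norm_def infnorm_pos_le)

lemma lp_norm_scaleR:
  assumes "1 \<le> p"
  shows "lp_norm p (c *\<^sub>R z) = \<bar>c\<bar> * lp_norm p z"
proof (cases p)
  case top
  then show ?thesis by (simp add: lp_norm_def infnorm_mul)
next
  case (real q)
  then have q: "1 \<le> q" using assms by simp
  have "(\<Sum>i\<in>UNIV. \<bar>(c *\<^sub>R z) $ i\<bar> powr q) = \<bar>c\<bar> powr q * (\<Sum>i\<in>UNIV. \<bar>z $ i\<bar> powr q)"
    by (simp add: abs_mult powr_mult sum_distrib_left)
  then show ?thesis
    using real q by (simp add: lp_norm_ennreal powr_mult sum_nonneg powr_powr)
qed

text \<open>The constant is crude on purpose: any finite factor suffices to make the supremum in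
  \<open>outer_radius\<close> finite and, together with Hoelder, \<open>inner_radius\<close>
  positive. Every coordinate is at most the Euclidean norm, which gives the factor
  \<open>CARD('d) powr (1 / q)\<close>, and \<open>1 / q\<close> is at most 1.\<close>

lemma lp_norm_le_norm:
  fixes z :: "real ^ 'd"
  assumes "1 \<le> p"
  shows "lp_norm p z \<le> real CARD('d) * norm z"
proof (cases p)
  case top
  have "infnorm z \<le> 1 * norm z" by (simp add: infnorm_le_norm)
  also have "\<dots> \<le> real CARD('d) * norm z"
    by (intro mult_right_mono) (simp_all add: Suc_le_eq)
  finally show ?thesis using top by (simp add: lp_norm_def)
next
  case (real q)
  then have q: "1 \<le> q" using assms by simp
  have d: "1 \<le> real CARD('d)" by (simp add: Suc_le_eq)
  have "(\<Sum>i\<in>UNIV. \<bar>z $ i\<bar> powr q) \<le> (\<Sum>i\<in>(UNIV::'d set). norm z powr q)"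
    using q by (intro sum_mono powr_mono2) (auto intro: component_le_norm_cart)
  then have "(\<Sum>i\<in>UNIV. \<bar>z $ i\<bar> powr q) powr (1 / q) \<le> (real CARD('d) * norm z powr q) powr (1 / q)"
    using q by (intro powr_mono2) (auto intro: sum_nonneg)
  also have "\<dots> = real CARD('d) powr (1 / q) * norm z"
    using q by (simp add: powr_mult powr_powr)
  also have "\<dots> \<le> real CARD('d) powr 1 * norm z"
    using q d by (intro mult_right_mono powr_mono) auto
  finally show ?thesis using real by (simp add: lp_norm_ennreal)
qed

section \<open>Hoelder's inequality and its equality case\<close>

lemma Holder_finite:
  fixes w z :: "real ^ 'd"
  assumes "1 < p" "1 < q" "1 / p + 1 / q = 1"
  shows "w \<bullet> z \<le> lp_norm (ennreal p) w * lp_norm (ennreal q) z"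
proof -
  define A where "A = (\<Sum>i\<in>UNIV. \<bar>w $ i\<bar> powr p)"
  define B where "B = (\<Sum>i\<in>UNIV. \<bar>z $ i\<bar> powr q)"
  define a where "a = A powr (1 / p)"
  define b where "b = B powr (1 / q)"
  have AB: "0 \<le> A" "0 \<le> B" by (simp_all add: A_def B_def sum_nonneg)
  show ?thesis
  \<comment> \<open>A zero vector cannot be normalized, but then the inner product vanishes.\<close>
  proof (cases "A = 0 \<or> B = 0")
    case True
    have "w = 0" if "A = 0"
      using that unfolding A_def by (subst (asm) sum_nonneg_eq_0_iff) (auto simp: vec_eq_iff)
    moreover have "z = 0" if "B = 0"
      using that unfolding B_def by (subst (asm) sum_nonneg_eq_0_iff) (auto simp: vec_eq_iff)
    ultimately have "w \<bullet> z = 0" using True by auto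
    then show ?thesis by (simp add: lp_norm_nonneg)
  next
    case False
    then have pos: "0 < A" "0 < B" "0 < a" "0 < b"
      using AB by (auto simp: a_def b_def)
    have ap: "a powr p = A" "b powr q = B"
      using assms pos by (simp_all add: a_def b_def powr_powr)
    have "w \<bullet> z \<le> (\<Sum>i\<in>UNIV. \<bar>w $ i\<bar> * \<bar>z $ i\<bar>)"
      unfolding inner_vec_def by (intro sum_mono) (simp flip: abs_mult)
    \<comment> \<open>Normalize both vectors to norm 1; Young's inequality in each coordinate then
      sums to 1 / p + 1 / q = 1.\<close>
    also have "\<dots> = a * b * (\<Sum>i\<in>UNIV. (\<bar>w $ i\<bar> / a) * (\<bar>z $ i\<bar> / b))"
      using pos by (simp add: sum_distrib_left)
    also have "\<dots> \<le> a * b * (\<Sum>i\<in>UNIV. (\<bar>w $ i\<bar> / a) powr p / p + (\<bar>z $ i\<bar> / b) powr q / q)"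
      using pos assms by (intro mult_left_mono sum_mono Youngs_inequality) auto
    also have "(\<Sum>i\<in>UNIV. (\<bar>w $ i\<bar> / a) powr p / p + (\<bar>z $ i\<bar> / b) powr q / q) = 1"
    proof -
      have "(\<Sum>i\<in>UNIV. (\<bar>w $ i\<bar> / a) powr p / p + (\<bar>z $ i\<bar> / b) powr q / q)
          = A / A / p + B / B / q"
        using pos by (simp add: sum.distrib powr_divide ap A_def B_def flip: sum_divide_distrib)
      then show ?thesis using pos assms by simp
    qed
    finally show ?thesis
      using assms by (simp add: lp_norm_ennreal a_def b_def A_def B_def)
  qed
qed

lemma inner_le_lp_norm_1_infnorm: "w \<bullet> z \<le> lp_norm 1 w * infnorm z" for w z :: "real ^ 'd"
proof -
  have "w \<bullet> z \<le> (\<Sum>i\<in>UNIV. \<bar>w $ i\<bar> * \<bar>z $ i\<bar>)"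
    unfolding inner_vec_def by (intro sum_mono) (simp flip: abs_mult)
  also have "\<dots> \<le> (\<Sum>i\<in>UNIV. \<bar>w $ i\<bar> * infnorm z)"
    by (intro sum_mono mult_left_mono component_le_infnorm_cart) auto
  finally show ?thesis by (simp add: lp_norm_1 sum_distrib_right)
qed

lemma Holder:
  assumes "1 \<le> \<tau>" "1 / \<tau> + 1 / \<nu> = 1"
  shows "w \<bullet> z \<le> lp_norm \<tau> w * lp_norm \<nu> z"
  using assms
proof (cases rule: conjugate_exponents_cases)
  case 1
  then show ?thesis
    using inner_le_lp_norm_1_infnorm[of z w]
    by (simp add: lp_norm_infty inner_commute mult.commute del: infinity_ennreal_def)
next
  case 2
  then show ?thesis
    using inner_le_lp_norm_1_infnorm[of w z]
    by (simp add: lp_norm_infty del: infinity_ennreal_def)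
next
  case (3 p q)
  then show ?thesis by (simp add: Holder_finite)
qed

lemma infnorm_attained:
  fixes w :: "real ^ 'd"
  obtains i where "infnorm w = \<bar>w $ i\<bar>"
proof -
  have "infnorm w = Max (range (\<lambda>i. \<bar>w $ i\<bar>))"
    by (simp add: infnorm_cart cSup_eq_Max full_SetCompr_eq)
  also have "\<dots> \<in> range (\<lambda>i. \<bar>w $ i\<bar>)"
    by (rule Max_in) auto
  finally show ?thesis using that by blast
qed

text \<open>Hoelder only bounds the support function of the \<nu>-ball from above; an extremal
  vector in each of the three exponent cases shows that the bound is its value.\<close>

lemma Holder_attained:
  fixes w :: "real ^ 'd"
  assumes "1 \<le> \<tau>" "1 / \<tau> + 1 / \<nu> = 1"
  obtains z where "lp_norm \<nu> z \<le> 1" "w \<bullet> z = lp_norm \<tau> w"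
  using assms
proof (cases rule: conjugate_exponents_cases)
  case 1
  \<comment> \<open>The extremal vector is a signed unit vector at a coordinate of w of largest
    modulus.\<close>
  obtain i where i: "infnorm w = \<bar>w $ i\<bar>" by (rule infnorm_attained)
  have "lp_norm 1 (axis i (sgn (w $ i))) = (\<Sum>j\<in>UNIV. if j = i then \<bar>sgn (w $ i)\<bar> else 0)"
    unfolding lp_norm_1 by (intro sum.cong) (auto simp: axis_def)
  then have "lp_norm \<nu> (axis i (sgn (w $ i))) \<le> 1"
    using 1 by (simp add: abs_sgn_eq)
  moreover have "w \<bullet> axis i (sgn (w $ i)) = lp_norm \<tau> w"
    using 1 i by (simp add: inner_axis lp_norm_infty abs_sgn del: infinity_ennreal_def)
  ultimately show ?thesis by (rule that)
next
  case 2
  \<comment> \<open>The sign vector turns the inner product into the sum of the moduli.\<close>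
  define z :: "real ^ 'd" where "z = (\<chi> i. sgn (w $ i))"
  obtain i where "infnorm z = \<bar>z $ i\<bar>" by (rule infnorm_attained)
  then have "lp_norm \<nu> z \<le> 1"
    using 2 by (simp add: lp_norm_infty z_def abs_sgn_eq del: infinity_ennreal_def)
  moreover have "w \<bullet> z = lp_norm \<tau> w"
    using 2 by (simp add: lp_norm_1 z_def inner_vec_def abs_sgn)
  ultimately show ?thesis by (rule that)
next
  case (3 p q)
  define A where "A = (\<Sum>i\<in>UNIV. \<bar>w $ i\<bar> powr p)"
  define a where "a = A powr (1 / p)"
  have a: "lp_norm \<tau> w = a" using 3 by (simp add: lp_norm_ennreal a_def A_def)
  show ?thesis
  proof (cases "A = 0")
    case True
    then show ?thesis
      using a 3 that[of 0] by (simp add: a_def lp_norm_ennreal)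
  next
    case False
    moreover have "0 \<le> A" by (simp add: A_def sum_nonneg)
    ultimately have pos: "0 < A" "0 < a" by (auto simp: a_def)
    have ap: "a powr p = A" using 3 pos by (simp add: a_def powr_powr)
    have one: "(\<Sum>i\<in>UNIV. (\<bar>w $ i\<bar> / a) powr p) = 1"
      using pos by (simp add: powr_divide ap A_def flip: sum_divide_distrib)
    \<comment> \<open>The equality case of Young's inequality: the modulus of each coordinate of z,
      raised to q, must equal the normalized modulus of that of w, raised to p. Since (p - 1) * q =
      p, the exponent p - 1 achieves this.\<close>
    define z :: "real ^ 'd" where "z = (\<chi> i. sgn (w $ i) * (\<bar>w $ i\<bar> / a) powr (p - 1))"
    have pq: "(p - 1) * q = p"
      using 3 by (simp add: field_simps)
    have "\<bar>z $ i\<bar> powr q = (\<bar>w $ i\<bar> / a) powr p" for i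
      using pos pq by (cases "w $ i = 0") (auto simp: z_def abs_mult abs_sgn_eq powr_powr)
    then have "lp_norm \<nu> z = 1"
      using 3 one by (simp add: lp_norm_ennreal)
    moreover have "w \<bullet> z = a"
    proof -
      have "w $ i * z $ i = a * (\<bar>w $ i\<bar> / a) powr p" for i
      proof -
        have "w $ i * z $ i = a * ((\<bar>w $ i\<bar> / a) * (\<bar>w $ i\<bar> / a) powr (p - 1))"
          using pos by (simp add: z_def abs_sgn)
        also have "(\<bar>w $ i\<bar> / a) * (\<bar>w $ i\<bar> / a) powr (p - 1) = (\<bar>w $ i\<bar> / a) powr p"
          using pos by (subst powr_mult_base) auto
        finally show ?thesis .
      qed
      then show ?thesis using one by (simp add: inner_vec_def flip: sum_distrib_left)
    qed
    ultimately show ?thesis using that[of z] a by simp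
  qed
qed

section \<open>The Minkowski functional of a symmetric polytope\<close>

lemma mem_scaleR_image_iff: "0 < t \<Longrightarrow> z \<in> (*\<^sub>R) t ` S \<longleftrightarrow> (1 / t) *\<^sub>R z \<in> S"
  for S :: "'a::real_vector set"
  by (auto simp: image_iff intro!: bexI[where x = "(1 / t) *\<^sub>R z"])

lemma ball_norm_eq: "ball_norm S z = Inf {t. 0 < t \<and> (1 / t) *\<^sub>R z \<in> S}"
  unfolding ball_norm_def by (rule arg_cong[where f = Inf]) (auto simp: mem_scaleR_image_iff)

lemma ball_norm_le:
  assumes "0 < s" "(1 / s) *\<^sub>R z \<in> S"
  shows "ball_norm S z \<le> s"
  unfolding ball_norm_eq using assms by (intro cInf_lower bdd_belowI[of _ 0]) auto

lemma ball_norm_le_1: "z \<in> S \<Longrightarrow> ball_norm S z \<le> 1"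
  using ball_norm_le[of 1] by simp

text \<open>By symmetry an interior point comes with its negative, and by convexity of the interior
  their midpoint is interior too.\<close>

lemma norm_ball_0_interior:
  assumes "norm_ball S"
  shows "0 \<in> interior S"
proof -
  have S: "convex S" "uminus ` S = S" "interior S \<noteq> {}"
    using assms by (auto simp: norm_ball_def polytope_imp_convex)
  then obtain a where a: "a \<in> interior S" by blast
  then have "- a \<in> interior S"
    using S(2) interior_negations[of S] by (metis imageI)
  then have "(1 / 2) *\<^sub>R a + (1 / 2) *\<^sub>R (- a) \<in> interior S"
    using a convex_interior[OF S(1)] by (intro convexD) auto
  then show ?thesis by simp
qed

lemma norm_ball_mem:
  fixes S :: "'a::euclidean_space set"
  assumes "norm_ball S"
  obtains e where "0 < e" "\<And>t z. 0 < t \<Longrightarrow> norm z \<le> e * t \<Longrightarrow> (1 / t) *\<^sub>R z \<in> S"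
proof -
  obtain e where e: "0 < e" "cball 0 e \<subseteq> S"
    using norm_ball_0_interior[OF assms] by (auto simp: mem_interior_cball)
  moreover have "(1 / t) *\<^sub>R z \<in> S" if "0 < t" "norm z \<le> e * t" for t z
    using that e(2) by (intro subsetD[OF e(2)]) (auto simp: field_simps)
  ultimately show ?thesis using that by blast
qed

lemma norm_ball_absorbing:
  fixes S :: "'a::euclidean_space set"
  assumes "norm_ball S"
  shows "{t. 0 < t \<and> (1 / t) *\<^sub>R z \<in> S} \<noteq> {}"
proof -
  obtain e where e: "0 < e" "\<And>t z. 0 < t \<Longrightarrow> norm z \<le> e * t \<Longrightarrow> (1 / t) *\<^sub>R z \<in> S"
    using norm_ball_mem[OF assms] by metis
  \<comment> \<open>The summand 1 keeps the scale positive when z = 0.\<close>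
  have "0 < norm z / e + 1" using e(1) by (simp add: add_nonneg_pos)
  moreover have "norm z \<le> e * (norm z / e + 1)" using e(1) by (simp add: field_simps)
  ultimately show ?thesis using e(2) by blast
qed

text \<open>Multiplication by c maps the admissible scales of z onto those of the scaled vector, and
  it commutes with the infimum because it is monotone and continuous.\<close>

lemma ball_norm_scaleR:
  fixes S :: "'a::euclidean_space set"
  assumes "norm_ball S" "0 < c"
  shows "ball_norm S (c *\<^sub>R z) = c * ball_norm S z"
proof -
  define T where "T = {t. 0 < t \<and> (1 / t) *\<^sub>R z \<in> S}"
  have "s \<in> (\<lambda>t. c * t) ` T" if "0 < s" "(1 / s) *\<^sub>R c *\<^sub>R z \<in> S" for s
    using that assms(2) by (intro image_eqI[where x = "s / c"]) (auto simp: T_def)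
  then have "{t. 0 < t \<and> (1 / t) *\<^sub>R c *\<^sub>R z \<in> S} = (\<lambda>t. c * t) ` T"
    using assms(2) by (auto simp: T_def)
  moreover have "c * Inf T = Inf ((\<lambda>t. c * t) ` T)"
  proof (rule continuous_at_Inf_mono)
    show "mono (\<lambda>t. c * t)" using assms(2) by (auto simp: mono_def)
    show "bdd_below T" by (rule bdd_belowI[of _ 0]) (auto simp: T_def)
    show "T \<noteq> {}" using norm_ball_absorbing[OF assms(1)] by (simp add: T_def)
  qed (intro continuous_intros)
  ultimately show ?thesis by (simp add: ball_norm_eq T_def)
qed

text \<open>The constant e is the radius of a Euclidean ball around 0 inside S, and M bounds the
  Euclidean norm on S.\<close>

lemma norm_ball_bounds:
  fixes S :: "'a::euclidean_space set"
  assumes "norm_ball S"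
  obtains e M where "0 < e" "0 < M" "\<And>z. e * ball_norm S z \<le> norm z" "\<And>z. norm z \<le> M * ball_norm S z"
proof -
  obtain e where e: "0 < e" "\<And>t z. 0 < t \<Longrightarrow> norm z \<le> e * t \<Longrightarrow> (1 / t) *\<^sub>R z \<in> S"
    using norm_ball_mem[OF assms] by metis
  have "bounded S" using assms by (simp add: norm_ball_def polytope_imp_bounded)
  then obtain M where M: "0 < M" "\<And>z. z \<in> S \<Longrightarrow> norm z \<le> M"
    by (auto simp: bounded_pos)
  have "e * ball_norm S z \<le> norm z" for z
  \<comment> \<open>Admissible scales are positive while the norm of z may be 0, hence the slack
    \<eta>.\<close>
  proof (rule field_le_epsilon)
    fix \<eta> :: real assume "0 < \<eta>"
    then have "ball_norm S z \<le> (norm z + \<eta>) / e"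
      using e(1) by (intro ball_norm_le e(2)) (auto simp: add_nonneg_pos)
    then show "e * ball_norm S z \<le> norm z + \<eta>" using e(1) by (simp add: field_simps)
  qed
  moreover have "norm z \<le> M * ball_norm S z" for z
  proof -
    have "norm z / M \<le> ball_norm S z"
      unfolding ball_norm_eq
    proof (rule cInf_greatest[OF norm_ball_absorbing[OF assms]])
      fix t assume "t \<in> {t. 0 < t \<and> (1 / t) *\<^sub>R z \<in> S}"
      then show "norm z / M \<le> t" using M(1) M(2)[of "(1 / t) *\<^sub>R z"] by (auto simp: field_simps)
    qed
    then show ?thesis using M(1) by (simp add: field_simps)
  qed
  ultimately show ?thesis using that e(1) M(1) by blast
qed

text \<open>The infimum is not known to be attained, so z itself is reached only as a limit: every
  strictly shrunk multiple of z lies in S, and S is closed.\<close>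

lemma ball_norm_le_1_imp_mem:
  fixes S :: "'a::euclidean_space set"
  assumes S: "norm_ball S" and z: "ball_norm S z \<le> 1"
  shows "z \<in> S"
proof -
  have cS: "convex S" "closed S" "0 \<in> S"
    using S norm_ball_0_interior[OF S] interior_subset
    by (auto simp: norm_ball_def polytope_imp_convex polytope_imp_closed)
  have mem: "u *\<^sub>R z \<in> S" if u: "0 < u" "u < 1" for u
  proof -
    have "Inf {t. 0 < t \<and> (1 / t) *\<^sub>R z \<in> S} < 1 / u"
      using z u by (simp add: ball_norm_eq less_divide_eq_1 order.strict_trans1)
    then obtain t where t: "0 < t" "(1 / t) *\<^sub>R z \<in> S" "t < 1 / u"
      using cInf_lessD[OF norm_ball_absorbing[OF S]] by auto
    then have ut: "u * t \<le> 1" using u by (simp add: field_simps)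
    \<comment> \<open>The vector \<open>u *\<^sub>R z\<close> is a convex combination of the point
      \<open>(1 / t) *\<^sub>R z\<close> of S and 0.\<close>
    have "(u * t) *\<^sub>R ((1 / t) *\<^sub>R z) + (1 - u * t) *\<^sub>R 0 \<in> S"
      using cS t u ut by (intro convexD) auto
    then show ?thesis using t by simp
  qed
  \<comment> \<open>The shift by 2 keeps every factor strictly between 0 and 1.\<close>
  have "(\<lambda>n. (1 - inverse (real (n + 2))) *\<^sub>R z) \<longlonglongrightarrow> (1 - 0) *\<^sub>R z"
    by (intro tendsto_intros LIMSEQ_ignore_initial_segment lim_inverse_n)
  moreover have "(1 - inverse (real (n + 2))) *\<^sub>R z \<in> S" for n
    by (intro mem) (auto simp: field_simps)
  ultimately show ?thesis
    using closed_sequentially[OF cS(2)] by fastforce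
qed

section \<open>The inner and outer radius as constants of norm comparison\<close>

lemma inner_radius_mult_ball_norm_le:
  fixes P :: "(real ^ 'd) set"
  assumes P: "norm_ball P" and "1 \<le> \<nu>"
  shows "inner_radius \<nu> P * ball_norm P z \<le> lp_norm \<nu> z"
proof -
  obtain M where M: "0 < M" "norm z \<le> M * ball_norm P z"
    using norm_ball_bounds[OF P] by metis
  show ?thesis
  proof (cases "ball_norm P z = 0")
    case True
    then show ?thesis by (simp add: lp_norm_nonneg)
  next
    case False
    moreover have "0 \<le> ball_norm P z"
      using M by (metis norm_ge_zero order_trans zero_le_mult_iff not_less)
    ultimately have b: "0 < ball_norm P z" by simp
    define c where "c = 1 / ball_norm P z"
    have c: "0 < c" using b by (simp add: c_def)
    have "inner_radius \<nu> P \<le> lp_norm \<nu> (c *\<^sub>R z)"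
      unfolding inner_radius_def
      using c b by (intro cINF_lower bdd_belowI2[where m = 0])
        (auto simp: lp_norm_nonneg ball_norm_scaleR[OF P] c_def)
    also have "\<dots> = lp_norm \<nu> z / ball_norm P z"
      using c assms(2) by (simp add: lp_norm_scaleR) (simp add: c_def)
    finally show ?thesis using b by (simp add: field_simps)
  qed
qed

text \<open>Without boundedness the real supremum defining \<open>outer_radius\<close> would not be
  an upper bound.\<close>

lemma bdd_above_lp_norm:
  fixes Q :: "(real ^ 'd) set"
  assumes Q: "norm_ball Q" and "1 \<le> \<nu>"
  shows "bdd_above (lp_norm \<nu> ` {z. ball_norm Q z = 1})"
proof -
  obtain M where M: "0 < M" "\<And>z. norm z \<le> M * ball_norm Q z"
    using norm_ball_bounds[OF Q] by metis
  show ?thesis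
  proof (rule bdd_aboveI2)
    fix z assume "z \<in> {z. ball_norm Q z = 1}"
    then have "real CARD('d) * norm z \<le> real CARD('d) * M"
      using M(2)[of z] by (intro mult_left_mono) auto
    then show "lp_norm \<nu> z \<le> real CARD('d) * M"
      using lp_norm_le_norm[OF assms(2), of z] by linarith
  qed
qed

text \<open>Lower bounds pass to the infimum in \<open>inner_radius\<close> only over a nonempty
  set. A basis vector has positive gauge and can be rescaled.\<close>

lemma norm_ball_unit_sphere_nonempty:
  fixes P :: "'a::euclidean_space set"
  assumes P: "norm_ball P"
  shows "{z. ball_norm P z = 1} \<noteq> {}"
proof -
  obtain M where M: "0 < M" "\<And>z. norm z \<le> M * ball_norm P z"
    using norm_ball_bounds[OF P] by metis
  obtain b :: 'a where "b \<in> Basis" using nonempty_Basis by blast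
  then have "0 < M * ball_norm P b" using M(2)[of b] by simp
  then have b: "0 < ball_norm P b" using M(1) by (simp add: zero_less_mult_iff)
  then have "ball_norm P ((1 / ball_norm P b) *\<^sub>R b) = 1"
    by (simp add: ball_norm_scaleR[OF P])
  then show ?thesis by blast
qed

text \<open>Pairing z with itself in Hoelder's inequality bounds its \<nu>-norm below by its
  Euclidean norm divided by the dimension, and on the unit sphere of P the Euclidean norm is at
  least e.\<close>

lemma inner_radius_pos:
  fixes P :: "(real ^ 'd) set"
  assumes P: "norm_ball P" and \<tau>: "1 \<le> \<tau>" "1 \<le> \<nu>" "1 / \<tau> + 1 / \<nu> = 1"
  shows "0 < inner_radius \<nu> P"
proof -
  obtain e M where eM: "0 < e" "0 < M"
      "\<And>z. e * ball_norm P z \<le> norm z" "\<And>z. norm z \<le> M * ball_norm P z"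
    using norm_ball_bounds[OF P] by metis
  have "e / real CARD('d) \<le> inner_radius \<nu> P"
    unfolding inner_radius_def
  proof (rule cINF_greatest[OF norm_ball_unit_sphere_nonempty[OF P]])
    fix z assume "z \<in> {z. ball_norm P z = 1}"
    then have z: "e \<le> norm z" using eM(3)[of z] by simp
    then have "0 < norm z" using eM(1) by linarith
    have "norm z * norm z \<le> lp_norm \<tau> z * lp_norm \<nu> z"
      using Holder[OF \<tau>(1,3), of z z] by (simp add: dot_square_norm power2_eq_square)
    also have "\<dots> \<le> real CARD('d) * norm z * lp_norm \<nu> z"
      by (intro mult_right_mono lp_norm_le_norm \<tau> lp_norm_nonneg)
    finally have "norm z * norm z \<le> norm z * (real CARD('d) * lp_norm \<nu> z)"
      by (simp add: mult_ac)
    then have "norm z \<le> real CARD('d) * lp_norm \<nu> z"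
      using \<open>0 < norm z\<close> by (metis mult_le_cancel_left_pos)
    with z show "e / real CARD('d) \<le> lp_norm \<nu> z"
      by (simp add: divide_le_eq mult.commute)
  qed
  then show ?thesis using eM(1) by (metis divide_pos_pos less_le_trans of_nat_0_less_iff zero_less_card_finite)
qed

lemma lp_norm_le_outer_radius_mult_ball_norm:
  fixes Q :: "(real ^ 'd) set"
  assumes Q: "norm_ball Q" and "1 \<le> \<nu>"
  shows "lp_norm \<nu> z \<le> outer_radius \<nu> Q * ball_norm Q z"
proof -
  obtain M where M: "0 < M" "norm z \<le> M * ball_norm Q z"
    using norm_ball_bounds[OF Q] by metis
  have nonneg: "0 \<le> ball_norm Q z"
    using M by (metis norm_ge_zero order_trans zero_le_mult_iff not_less)
  show ?thesis
  proof (cases "ball_norm Q z = 0")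
    case True
    \<comment> \<open>Rescaling to gauge 1 is impossible here, but gauge 0 forces z = 0 because
      P-type balls are bounded.\<close>
    then have "z = 0" using M by simp
    then show ?thesis using True lp_norm_le_norm[OF assms(2), of z] by simp
  next
    case False
    then have b: "0 < ball_norm Q z" using nonneg by simp
    define c where "c = 1 / ball_norm Q z"
    have c: "0 < c" using b by (simp add: c_def)
    have "lp_norm \<nu> z / ball_norm Q z = lp_norm \<nu> (c *\<^sub>R z)"
      using c assms(2) by (simp add: lp_norm_scaleR) (simp add: c_def)
    also have "\<dots> \<le> outer_radius \<nu> Q"
      unfolding outer_radius_def
      using c b by (intro cSUP_upper bdd_above_lp_norm assms) (auto simp: ball_norm_scaleR[OF Q] c_def)
    finally show ?thesis using b by (simp add: field_simps)
  qed
qed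

section \<open>The polar norm as a support function\<close>

lemma ball_norm_polar_eq: "ball_norm (polar S) w = Inf {t. 0 < t \<and> (\<forall>z\<in>S. w \<bullet> z \<le> t)}"
  \<comment> \<open>Clearing the positive denominator t turns the scales admissible for the polar
    set into the positive upper bounds of the functional w on S.\<close>
  unfolding ball_norm_eq polar_def by (rule arg_cong[where f = Inf]) (auto simp: field_simps)

text \<open>If S lies in the \<nu>-ball of radius c, Hoelder makes
  \<open>c * lp_norm \<tau> w\<close> an upper bound of w on S. The slack \<eta> makes it a positive
  one.\<close>

lemma ball_norm_polar_le:
  assumes conj: "1 \<le> \<tau>" "1 / \<tau> + 1 / \<nu> = 1" and "0 \<le> c" and S: "\<And>z. z \<in> S \<Longrightarrow> lp_norm \<nu> z \<le> c"
  shows "ball_norm (polar S) w \<le> c * lp_norm \<tau> w"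
proof (rule field_le_epsilon)
  fix \<eta> :: real assume \<eta>: "0 < \<eta>"
  have "w \<bullet> z \<le> c * lp_norm \<tau> w + \<eta>" if "z \<in> S" for z
  proof -
    have "w \<bullet> z \<le> lp_norm \<tau> w * lp_norm \<nu> z" by (rule Holder[OF conj])
    also have "\<dots> \<le> lp_norm \<tau> w * c" by (intro mult_left_mono S that lp_norm_nonneg)
    finally show ?thesis using \<eta> by (simp add: mult.commute)
  qed
  moreover have "0 < c * lp_norm \<tau> w + \<eta>"
    using \<eta> assms(3) by (simp add: add_nonneg_pos lp_norm_nonneg)
  ultimately show "ball_norm (polar S) w \<le> c * lp_norm \<tau> w + \<eta>"
    unfolding ball_norm_polar_eq by (intro cInf_lower bdd_belowI[of _ 0]) auto
qed

text \<open>Nonemptiness of this set is what allows lower bounds to be passed to the infimum in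
  \<open>ball_norm_polar_eq\<close>.\<close>

lemma bounded_imp_polar_absorbing:
  fixes S :: "'a::euclidean_space set"
  assumes "bounded S"
  shows "{t. 0 < t \<and> (\<forall>z\<in>S. w \<bullet> z \<le> t)} \<noteq> {}"
proof -
  obtain M where M: "0 < M" "\<And>z. z \<in> S \<Longrightarrow> norm z \<le> M"
    using assms by (auto simp: bounded_pos)
  have "w \<bullet> z \<le> norm w * M + 1" if "z \<in> S" for z
  proof -
    have "w \<bullet> z \<le> norm w * norm z" by (rule norm_cauchy_schwarz)
    also have "\<dots> \<le> norm w * M" by (intro mult_left_mono M(2) that) simp
    finally show ?thesis by simp
  qed
  moreover have "0 < norm w * M + 1" using M(1) by (simp add: add_nonneg_pos)
  ultimately show ?thesis by blast
qed

lemma ball_norm_polar_nonneg: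
  fixes S :: "'a::euclidean_space set"
  shows "bounded S \<Longrightarrow> 0 \<le> ball_norm (polar S) w"
  unfolding ball_norm_polar_eq by (intro cInf_greatest bounded_imp_polar_absorbing) auto

text \<open>The extremal vector of Hoelder's inequality, scaled by c, lies in S, so every upper
  bound of w on S is at least the value of w there.\<close>

lemma lp_norm_le_ball_norm_polar:
  fixes S :: "(real ^ 'd) set"
  assumes conj: "1 \<le> \<tau>" "1 \<le> \<nu>" "1 / \<tau> + 1 / \<nu> = 1" and "0 \<le> c" "bounded S"
    and S: "\<And>z. lp_norm \<nu> z \<le> c \<Longrightarrow> z \<in> S"
  shows "c * lp_norm \<tau> w \<le> ball_norm (polar S) w"
proof -
  obtain z where z: "lp_norm \<nu> z \<le> 1" "w \<bullet> z = lp_norm \<tau> w"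
    by (rule Holder_attained[OF conj(1,3)])
  have "c *\<^sub>R z \<in> S"
    using z(1) \<open>0 \<le> c\<close> mult_left_mono[of "lp_norm \<nu> z" 1 c]
    by (intro S) (simp add: lp_norm_scaleR[OF conj(2)])
  then show ?thesis
    unfolding ball_norm_polar_eq using z(2) \<open>bounded S\<close>
    by (intro cInf_greatest bounded_imp_polar_absorbing) fastforce+
qed

section \<open>Comparison of residuals\<close>

lemma residual_nonneg:
  assumes "hyperplane \<beta> \<noteq> {}" "\<And>z. 0 \<le> N z"
  shows "0 \<le> residual N \<beta> x"
  unfolding residual_def using assms by (intro cINF_greatest) auto

lemma residual_mono:
  assumes ne: "hyperplane \<beta> \<noteq> {}" and nonneg: "\<And>z. 0 \<le> N z" and "0 \<le> c"
    and le: "\<And>z. N z \<le> c * N' z"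
  shows "residual N \<beta> x \<le> c * residual N' \<beta> x"
\<comment> \<open>The proof for positive c divides by c; for c = 0 the functional N vanishes
  identically.\<close>
proof (cases "c = 0")
  case True
  then have "N = (\<lambda>_. 0)" using nonneg le by (intro ext antisym) auto
  then show ?thesis using True ne by (simp add: residual_def)
next
  case False
  then have c: "0 < c" using assms by simp
  have "residual N \<beta> x / c \<le> residual N' \<beta> x"
    unfolding residual_def[of N']
  proof (rule cINF_greatest[OF ne])
    fix y assume "y \<in> hyperplane \<beta>"
    then have "residual N \<beta> x \<le> N (snd x - y)"
      unfolding residual_def using nonneg by (intro cINF_lower bdd_belowI2[where m = 0]) auto
    also have "\<dots> \<le> c * N' (snd x - y)" by (rule le)
    finally show "residual N \<beta> x / c \<le> N' (snd x - y)" using c by (simp add: field_simps)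
  qed
  then show ?thesis using c by (simp add: field_simps)
qed

section \<open>Order statistics and the globalizing function\<close>

lemma sorted_nth_le_iff:
  fixes ys :: "'a::linorder list"
  assumes "sorted ys" "i < length ys"
  shows "ys ! i \<le> v \<longleftrightarrow> i < length (filter (\<lambda>y. y \<le> v) ys)"
  using assms
proof (induction ys arbitrary: i)
  case (Cons y ys)
  \<comment> \<open>In a sorted list the entries at most v form an initial segment, so indices from
    0 are compared with its length.\<close>
  show ?case
  proof (cases "y \<le> v")
    case True
    then show ?thesis using Cons by (cases i) auto
  next
    case False
    then have "filter (\<lambda>y. y \<le> v) ys = []"
      using Cons.prems(1) by (auto simp: filter_empty_conv)
    moreover have "\<not> (y # ys) ! i \<le> v"
      using False Cons.prems by (cases i) (auto dest!: nth_mem)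
    ultimately show ?thesis using False by simp
  qed
qed simp

lemma length_filter_mono:
  "(\<And>x. x \<in> set xs \<Longrightarrow> A x \<Longrightarrow> B x) \<Longrightarrow> length (filter A xs) \<le> length (filter B xs)"
  by (induction xs) (auto simp: le_SucI)

text \<open>The permutations that sort the two lists may differ, so entries are counted instead of
  matched: with the threshold v taken as the entry for g, at least as many values of f as of g are
  at most v.\<close>

lemma sort_nth_mono:
  fixes f g :: "'b \<Rightarrow> 'a::linorder"
  assumes le: "\<And>x. x \<in> set xs \<Longrightarrow> f x \<le> g x" and i: "i < length xs"
  shows "sort (map f xs) ! i \<le> sort (map g xs) ! i"
proof -
  let ?v = "sort (map g xs) ! i"
  have len: "length (filter (\<lambda>y. y \<le> ?v) (sort ys)) = length (filter (\<lambda>y. y \<le> ?v) ys)" for ys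
    by (simp add: filter_sort)
  have "i < length (filter (\<lambda>y. y \<le> ?v) (sort (map g xs)))"
    using i by (subst sorted_nth_le_iff[symmetric]) auto
  also have "\<dots> = length (filter (\<lambda>x. g x \<le> ?v) xs)"
    unfolding len by (simp add: filter_map comp_def)
  also have "\<dots> \<le> length (filter (\<lambda>x. f x \<le> ?v) xs)"
    using le by (intro length_filter_mono) (meson order_trans)
  also have "\<dots> = length (filter (\<lambda>y. y \<le> ?v) (sort (map f xs)))"
    unfolding len by (simp add: filter_map comp_def)
  finally show ?thesis
    using i by (subst sorted_nth_le_iff) auto
qed

text \<open>This pulls the nonnegative factor c out of the order statistics.\<close>

lemma sort_map_mono: "mono f \<Longrightarrow> sort (map f xs) = map f (sort xs)"
  for f :: "'a::linorder \<Rightarrow> 'b::linorder"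
  by (rule properties_for_sort) (auto simp: sorted_map_mono mono_imp_mono_on)

lemma ordered_sum_mono:
  assumes "0 \<le> c" "0 \<le> \<delta>" and lam: "\<And>i. i < n \<Longrightarrow> 0 \<le> lam i"
    and nonneg: "\<And>i. 0 \<le> \<epsilon> i" "\<And>i. 0 \<le> \<epsilon>' i"
    and le: "\<And>i. \<epsilon> i \<le> c * \<epsilon>' i"
  shows "ordered_sum n lam \<delta> \<epsilon> \<le> c powr \<delta> * ordered_sum n lam \<delta> \<epsilon>'"
proof -
  \<comment> \<open>Monotonicity and multiplicativity of \<open>powr\<close> are applied to
    nonnegative bases; sorted entries are entries of the original list.\<close>
  have nonneg_sort: "0 \<le> sort (map f [0..<n]) ! i" if "i < n" "\<And>i. 0 \<le> f i"
    for f :: "nat \<Rightarrow> real" and i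
    using that nth_mem[of i "sort (map f [0..<n])"] by auto
  have "lam i * (sort (map \<epsilon> [0..<n]) ! i) powr \<delta>
      \<le> c powr \<delta> * (lam i * (sort (map \<epsilon>' [0..<n]) ! i) powr \<delta>)" if i: "i < n" for i
  proof -
    have "sort (map \<epsilon> [0..<n]) ! i \<le> sort (map (\<lambda>i. c * \<epsilon>' i) [0..<n]) ! i"
      using i le by (intro sort_nth_mono) auto
    also have "map (\<lambda>i. c * \<epsilon>' i) [0..<n] = map ((*) c) (map \<epsilon>' [0..<n])" by simp
    also have "sort \<dots> = map ((*) c) (sort (map \<epsilon>' [0..<n]))"
      using \<open>0 \<le> c\<close> by (intro sort_map_mono monoI mult_left_mono)
    finally have "sort (map \<epsilon> [0..<n]) ! i \<le> c * sort (map \<epsilon>' [0..<n]) ! i"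
      using i by simp
    then have "(sort (map \<epsilon> [0..<n]) ! i) powr \<delta> \<le> (c * sort (map \<epsilon>' [0..<n]) ! i) powr \<delta>"
      using i assms by (intro powr_mono2 nonneg_sort) auto
    also have "\<dots> = c powr \<delta> * (sort (map \<epsilon>' [0..<n]) ! i) powr \<delta>"
      using i assms by (simp add: powr_mult nonneg_sort)
    finally show ?thesis using lam[OF i] by (metis mult.left_commute mult_left_mono)
  qed
  then show ?thesis
    unfolding ordered_sum_def sum_distrib_left by (intro sum_mono) simp
qed

lemma ordered_sum_nonneg:
  assumes "\<And>i. i < n \<Longrightarrow> 0 \<le> lam i"
  shows "0 \<le> ordered_sum n lam \<delta> \<epsilon>"
  unfolding ordered_sum_def using assms by (intro sum_nonneg mult_nonneg_nonneg) auto

theorem theorem24: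
  fixes \<tau> \<nu> :: ennreal
    and P Q :: "(real ^ 'd) set"
    and r R \<delta> :: real
    and n :: nat
    and lam :: "nat \<Rightarrow> real"
    and x :: "nat \<Rightarrow> real \<times> (real ^ 'd)"
    and \<beta> :: "real \<times> (real ^ 'd)"
  defines "\<Phi> \<equiv> \<lambda>N. ordered_sum n lam \<delta> (\<lambda>i. residual N \<beta> (x i))"
  assumes "1 \<le> \<tau>" and "1 / \<tau> + 1 / \<nu> = 1"
    and "norm_ball P" and "P \<subseteq> {z. lp_norm \<nu> z \<le> 1}"
    and "r = inner_radius \<nu> P"
    and "norm_ball Q" and "{z. lp_norm \<nu> z \<le> 1} \<subseteq> Q"
    and "R = outer_radius \<nu> Q"
    and "0 < \<delta>"
    and "\<And>i. i < n \<Longrightarrow> 0 \<le> lam i"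
    and "\<And>i. i < n \<Longrightarrow> fst (x i) = 1"
    and "hyperplane \<beta> \<noteq> {}"
  shows "(\<Phi> (ball_norm (polar P)) \<le> \<Phi> (lp_norm \<tau>) \<and>
          \<Phi> (lp_norm \<tau>) \<le> 1 / r powr \<delta> * \<Phi> (ball_norm (polar P))) \<and>
         (1 / R powr \<delta> * \<Phi> (ball_norm (polar Q)) \<le> \<Phi> (lp_norm \<tau>) \<and>
          \<Phi> (lp_norm \<tau>) \<le> \<Phi> (ball_norm (polar Q)))"
proof -
  have "1 \<le> \<nu>"
    using assms(2,3) by (cases rule: conjugate_exponents_cases) auto
  note conj = \<open>1 \<le> \<tau>\<close> \<open>1 \<le> \<nu>\<close> \<open>1 / \<tau> + 1 / \<nu> = 1\<close>
  have bounded: "bounded P" "bounded Q"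
    using assms by (simp_all add: norm_ball_def polytope_imp_bounded)
  \<comment> \<open>Each of the four bounds is reduced to a pointwise inequality of norms; the
    constants c will be 1, 1, 1 / r and R.\<close>
  have transfer: "\<Phi> N \<le> c powr \<delta> * \<Phi> N'"
    if "\<And>z. 0 \<le> N z" "\<And>z. 0 \<le> N' z" "0 \<le> c" "\<And>z. N z \<le> c * N' z" for N N' c
    unfolding \<Phi>_def using that assms
    by (intro ordered_sum_mono residual_mono residual_nonneg) auto
  note nonneg = ball_norm_polar_nonneg[OF bounded(1)] ball_norm_polar_nonneg[OF bounded(2)] lp_norm_nonneg

  have "\<Phi> (ball_norm (polar P)) \<le> 1 powr \<delta> * \<Phi> (lp_norm \<tau>)"
    using assms conj by (intro transfer nonneg ball_norm_polar_le[where c = 1]) auto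
  moreover have "\<Phi> (lp_norm \<tau>) \<le> 1 powr \<delta> * \<Phi> (ball_norm (polar Q))"
  proof -
    have "1 * lp_norm \<tau> w \<le> ball_norm (polar Q) w" for w
      using assms by (intro lp_norm_le_ball_norm_polar[OF conj] bounded) auto
    then show ?thesis by (intro transfer nonneg) auto
  qed
  moreover have "\<Phi> (lp_norm \<tau>) \<le> 1 / r powr \<delta> * \<Phi> (ball_norm (polar P))"
  proof -
    have r: "0 < r" using inner_radius_pos[OF \<open>norm_ball P\<close> conj] assms by simp
    \<comment> \<open>The \<nu>-ball of radius r lies in P: there the gauge of P is at most
      1.\<close>
    have "z \<in> P" if "lp_norm \<nu> z \<le> r" for z
    proof (rule ball_norm_le_1_imp_mem[OF \<open>norm_ball P\<close>])
      have "r * ball_norm P z \<le> r * 1"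
        using inner_radius_mult_ball_norm_le[OF \<open>norm_ball P\<close> \<open>1 \<le> \<nu>\<close>, of z] that assms by simp
      then show "ball_norm P z \<le> 1" using r by (simp only: mult_le_cancel_left_pos)
    qed
    then have "r * lp_norm \<tau> w \<le> ball_norm (polar P) w" for w
      using r by (intro lp_norm_le_ball_norm_polar[OF conj] bounded) auto
    then have "\<Phi> (lp_norm \<tau>) \<le> (1 / r) powr \<delta> * \<Phi> (ball_norm (polar P))"
      using r by (intro transfer nonneg) (auto simp: field_simps)
    then show ?thesis using r by (simp add: powr_divide)
  qed
  moreover have "1 / R powr \<delta> * \<Phi> (ball_norm (polar Q)) \<le> \<Phi> (lp_norm \<tau>)"
  proof -
    have *: "lp_norm \<nu> z \<le> R * ball_norm Q z" for z
      using lp_norm_le_outer_radius_mult_ball_norm[OF \<open>norm_ball Q\<close> \<open>1 \<le> \<nu>\<close>] assms by simp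
    \<comment> \<open>Any point of the unit sphere of Q shows that R is nonnegative.\<close>
    obtain z where "ball_norm Q z = 1"
      using norm_ball_unit_sphere_nonempty[OF \<open>norm_ball Q\<close>] by blast
    then have "0 \<le> R" using *[of z] lp_norm_nonneg[of \<nu> z] by simp
    have "lp_norm \<nu> z \<le> R" if "z \<in> Q" for z
      using *[of z] mult_left_mono[OF ball_norm_le_1[OF that] \<open>0 \<le> R\<close>] by linarith
    then have "\<Phi> (ball_norm (polar Q)) \<le> R powr \<delta> * \<Phi> (lp_norm \<tau>)"
      using \<open>0 \<le> R\<close> by (intro transfer nonneg ball_norm_polar_le[OF conj(1,3)]) auto
    moreover have "0 \<le> \<Phi> (lp_norm \<tau>)"
      unfolding \<Phi>_def using assms by (intro ordered_sum_nonneg) auto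
    ultimately show ?thesis
      \<comment> \<open>Only nonnegativity of R has been established. For R = 0 the factor
        \<open>1 / R powr \<delta>\<close> is 0 by convention, and the bound reduces to
        nonnegativity of \<open>\<Phi> (lp_norm \<tau>)\<close>.\<close>
      by (cases "R = 0") (auto simp: field_simps)
  qed
  ultimately show ?thesis by simp
qed

end
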